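(* Let $E$ be a finite set and let $R\subseteq 2^{E}\times 2^{E}$ be an equivalence relation on $2^{E}$. Then there exists a violator space $(E,\varphi)$ such that for all $X,Y\subseteq E$, $(X,Y)\in R$ if and only if $\varphi(X)=\varphi(Y)$, if and only if the following hold for all $X,Y,Z\subseteq E$: (R1) if $(X,Y)\in R$, then $(X,X\cup Y)\in R$; (R2) if $X\subseteq Y\subseteq Z$ and $(X,Z)\in R$, then $(X,Y)\in R$.
   Context: A violator space is a pair $(E,\varphi)$ with $E$ finite and $\varphi:2^E\to 2^E$ such that for all $X,Y\subseteq E$: (V1) $X\subseteq\varphi(X)$, and (V2) if $X\subseteq Y\subseteq\varphi(X)$ then $\varphi(X)=\varphi(Y)$. The cospanning relation of $(E,\varphi)$ is the equivalence relation on $2^E$ in which $X$ and $Y$ are related iff $\varphi(X)=\varphi(Y)$. *)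

theory Defs
  imports Main "HOL-Library.FuncSet"
begin

text \<open>
  A set operator on the subsets of \<open>E\<close> is rendered as a HOL function on all sets that maps
  \<open>Pow E\<close> to \<open>Pow E\<close>; its values outside \<open>Pow E\<close> are irrelevant.
\<close>

locale violator_space =
  fixes E :: "'a set" and \<phi> :: "'a set \<Rightarrow> 'a set"
  assumes finite_ground: "finite E"
    and operator: "\<phi> \<in> Pow E \<rightarrow> Pow E"
    and extensive: "\<And>X. X \<subseteq> E \<Longrightarrow> X \<subseteq> \<phi> X"
    and self_convex: "\<And>X Y. X \<subseteq> E \<Longrightarrow> Y \<subseteq> E \<Longrightarrow> X \<subseteq> Y \<Longrightarrow> Y \<subseteq> \<phi> X \<Longrightarrow> \<phi> X = \<phi> Y"

end

theory Submission
  imports Defs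
begin

text \<open>
  For the converse direction, (R1) makes every class of \<open>R\<close> closed under unions, so each class
  has a greatest element, and \<open>\<phi> X\<close> can be taken to be the greatest element of the class
  of \<open>X\<close>; (R2) then says precisely that \<open>\<phi>\<close> is self-convex.
\<close>

text \<open>(R1) handles two sets at a time, so induction on the finite family \<open>F\<close>
  extends it to finite unions. Keeping \<open>X\<close> in the union makes the empty family
  harmless: its union need not be related to \<open>X\<close>.\<close>

lemma class_Union_closed:
  fixes R :: "('a set \<times> 'a set) set"
  assumes R: "equiv (Pow E) R"
    and R1: "\<And>X Y. (X, Y) \<in> R \<Longrightarrow> (X, X \<union> Y) \<in> R"
    and X: "X \<subseteq> E"
    and F: "finite F" "F \<subseteq> R `` {X}"
  shows "(X, X \<union> \<Union>F) \<in> R"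
  using F
proof (induction F rule: finite_induct)
  case empty
  show ?case using R X by (simp add: equiv_class_eq_iff)
next
  case (insert A F)
  have A: "(X, A) \<in> R" and U: "(X, X \<union> \<Union>F) \<in> R"
    using insert by auto
  \<comment> \<open>Both sets are related to \<open>X\<close>, hence to each other, and (R1) for
    this pair adjoins \<open>A\<close> to the union built so far.\<close>
  have "(A, X \<union> \<Union>F) \<in> R"
    using R A U by (simp add: equiv_class_eq_iff)
  then have "(A, A \<union> (X \<union> \<Union>F)) \<in> R"
    by (rule R1)
  then have "(X, A \<union> (X \<union> \<Union>F)) \<in> R"
    using R A by (simp add: equiv_class_eq_iff)
  then show ?case by (simp add: Un_left_commute)
qed

text \<open>Finiteness of \<open>E\<close> makes the class of \<open>X\<close> finite, so the whole
  class can serve as the family \<open>F\<close>; the extra \<open>X\<close> is absorbed because it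
  is a member of its own class.\<close>

lemma class_greatest:
  fixes R :: "('a set \<times> 'a set) set"
  assumes "finite E" and R: "equiv (Pow E) R"
    and R1: "\<And>X Y. (X, Y) \<in> R \<Longrightarrow> (X, X \<union> Y) \<in> R"
    and X: "X \<subseteq> E"
  shows "(X, \<Union>(R `` {X})) \<in> R"
proof -
  have "R `` {X} \<subseteq> Pow E"
    using R by (auto simp: equiv_class_eq_iff)
  then have "finite (R `` {X})"
    using \<open>finite E\<close> by (meson finite_Pow_iff finite_subset)
  then have "(X, X \<union> \<Union>(R `` {X})) \<in> R"
    using class_Union_closed[OF R R1 X] by blast
  moreover have "X \<in> R `` {X}"
    using R X by (simp add: equiv_class_eq_iff)
  then have "X \<union> \<Union>(R `` {X}) = \<Union>(R `` {X})" by blast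
  ultimately show ?thesis by simp
qed

theorem theorem2:
  fixes E :: "'a set" and R :: "('a set \<times> 'a set) set"
  assumes "finite E" and "equiv (Pow E) R"
  shows "(\<exists>\<phi>. violator_space E \<phi> \<and>
            (\<forall>X Y. X \<subseteq> E \<longrightarrow> Y \<subseteq> E \<longrightarrow> ((X, Y) \<in> R \<longleftrightarrow> \<phi> X = \<phi> Y)))
    \<longleftrightarrow>
      ((\<forall>X Y. X \<subseteq> E \<longrightarrow> Y \<subseteq> E \<longrightarrow> (X, Y) \<in> R \<longrightarrow> (X, X \<union> Y) \<in> R) \<and>
       (\<forall>X Y Z. X \<subseteq> E \<longrightarrow> Y \<subseteq> E \<longrightarrow> Z \<subseteq> E \<longrightarrow> X \<subseteq> Y \<longrightarrow> Y \<subseteq> Z \<longrightarrow>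
          (X, Z) \<in> R \<longrightarrow> (X, Y) \<in> R))"
    (is "?L \<longleftrightarrow> ?R1 \<and> ?R2")
proof (intro iffI conjI)
  assume ?L
  then obtain \<phi> where "violator_space E \<phi>"
    and iff: "\<And>X Y. X \<subseteq> E \<Longrightarrow> Y \<subseteq> E \<Longrightarrow> (X, Y) \<in> R \<longleftrightarrow> \<phi> X = \<phi> Y"
    by blast
  then interpret violator_space E \<phi> by simp
  show ?R1
  proof (intro allI impI)
    fix X Y assume XY: "X \<subseteq> E" "Y \<subseteq> E" "(X, Y) \<in> R"
    \<comment> \<open>Since \<phi> X = \<phi> Y, extensivity places both sets inside \<phi> X, so
      their union lies between \<open>X\<close> and \<phi> X.\<close>
    then have "X \<union> Y \<subseteq> \<phi> X"
      using extensive[of X] extensive[of Y] iff by auto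
    then show "(X, X \<union> Y) \<in> R"
      using XY iff self_convex[of X "X \<union> Y"] by simp
  qed
  show ?R2
  proof (intro allI impI)
    fix X Y Z
    assume sub: "X \<subseteq> E" "Y \<subseteq> E" "Z \<subseteq> E" "X \<subseteq> Y" "Y \<subseteq> Z" and "(X, Z) \<in> R"
    \<comment> \<open>Here \<open>Y\<close> is squeezed in by Y \<subseteq> Z \<subseteq> \<phi> Z =
      \<phi> X.\<close>
    then have "Y \<subseteq> \<phi> X"
      using extensive[of Z] iff by auto
    then show "(X, Y) \<in> R"
      using sub iff self_convex[of X Y] by simp
  qed
next
  assume R12: "?R1 \<and> ?R2"
  \<comment> \<open>As \<open>R\<close> lives on \<open>Pow E\<close>, being related already forces
    the bounds by \<open>E\<close>; this frees (R1) and (R2) of their side conditions, as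
    \<open>class_greatest\<close> expects.\<close>
  have dom: "X \<subseteq> E \<and> Y \<subseteq> E" if "(X, Y) \<in> R" for X Y
    using that assms(2) by (simp add: equiv_class_eq_iff)
  have R1: "(X, X \<union> Y) \<in> R" if "(X, Y) \<in> R" for X Y
    using R12 that dom[OF that] by simp
  have R2: "(X, Y) \<in> R" if "X \<subseteq> Y" "Y \<subseteq> Z" "(X, Z) \<in> R" for X Y Z
  proof -
    have "Y \<subseteq> E"
      using that(2) dom[OF that(3)] by blast
    then show ?thesis
      using R12 that dom[OF that(3)] by blast
  qed
  define \<phi> where "\<phi> X = \<Union>(R `` {X})" for X
  have greatest: "(X, \<phi> X) \<in> R" if "X \<subseteq> E" for X
    unfolding \<phi>_def using assms R1 that by (rule class_greatest)
  have iff: "(X, Y) \<in> R \<longleftrightarrow> \<phi> X = \<phi> Y" if "X \<subseteq> E" "Y \<subseteq> E" for X Y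
  proof
    assume "(X, Y) \<in> R"
    then show "\<phi> X = \<phi> Y"
      unfolding \<phi>_def using assms(2) by (simp add: equiv_class_eq)
  next
    \<comment> \<open>The common value is related to both \<open>X\<close> and \<open>Y\<close>, so
      it links them by symmetry and transitivity.\<close>
    assume "\<phi> X = \<phi> Y"
    then show "(X, Y) \<in> R"
      using greatest[OF that(1)] greatest[OF that(2)] assms(2)
      by (simp add: equiv_class_eq_iff)
  qed
  have "violator_space E \<phi>"
  proof
    show "finite E" by fact
    show "\<phi> \<in> Pow E \<rightarrow> Pow E"
      using greatest dom by blast
    show "X \<subseteq> \<phi> X" if "X \<subseteq> E" for X
      unfolding \<phi>_def using equiv_class_self[OF assms(2)] that by blast
    show "\<phi> X = \<phi> Y" if "X \<subseteq> E" "Y \<subseteq> E" "X \<subseteq> Y" "Y \<subseteq> \<phi> X" for X Y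
    proof -
      \<comment> \<open>(R2) is applied with \<phi> X as the largest of the three sets, which is
        possible because \<phi> X belongs to the class of \<open>X\<close>.\<close>
      have "(X, Y) \<in> R"
        using that(3,4) greatest[OF that(1)] by (rule R2)
      then show ?thesis using iff[OF that(1,2)] by simp
    qed
  qed
  then show ?L using iff by blast
qed

end
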